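(* There is an absolute constant $c>0$ such that the following holds. Let $w,N$ be integers with $0<w<2w\le N$. Let $Q$ be a quantum query algorithm that makes $T$ queries to membership oracles for two sets $A_0,A_1\subseteq[N]$, and suppose there is a real number $\alpha>0$ such that for every pair $(A_0,A_1)$ in which each $A_i$ satisfies $|A_i|\le w$ or $|A_i|\ge 2w$: if $|A_0|\ge 2w$ and $|A_1|\ge 2w$ then $Q$ accepts with probability at least $2\alpha$, and if $|A_0|\le w$ or $|A_1|\le w$ then $Q$ accepts with probability at most $\alpha$. Then $T \ge c\cdot \min\left\{\sqrt{w},\sqrt{N/w}\right\}$.
   Context: $[N]=\{1,2,\ldots,N\}$. A membership oracle for a set $A\subseteq[N]$ is the standard quantum oracle $|i,b\rangle\mapsto|i,b\oplus[i\in A]\rangle$; access to two oracles means the query register additionally contains a bit selecting which of $A_0,A_1$ is queried. The algorithm described is an "$\mathsf{SBQP}$ algorithm" for the problem $\mathsf{AND}_2\circ\mathsf{ApxCount}_{N,w}$: given $A_0,A_1$ each promised to have size $\le w$ or $\ge 2w$, decide whether both have size $\ge 2w$. *)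

theory Defs
  imports "HOL-Analysis.Analysis"
begin

(* A computational basis state |s, i, b, z>: s selects which of the two oracles is
   queried, i is the queried element of [N] = {1..N}, b is the answer bit, and z < m
   is the content of an m-dimensional workspace. *)

type_synonym basis_state = "bool \<times> nat \<times> bool \<times> nat"

type_synonym state = "basis_state \<Rightarrow> complex"

(* M x y is the matrix entry <x| M |y>. *)
type_synonym operator = "basis_state \<Rightarrow> basis_state \<Rightarrow> complex"

(* Dimensions depend on the natural numbers N and m, so the Hilbert space is the one
   spanned by an explicit finite set of basis states.  Entries of states and operators
   outside this set are never used. *)
definition basis :: "nat \<Rightarrow> nat \<Rightarrow> basis_state set" where
  "basis N m = (UNIV :: bool set) \<times> {1..N} \<times> (UNIV :: bool set) \<times> {..<m}"

definition ket :: "basis_state \<Rightarrow> state" where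
  "ket y = (\<lambda>x. of_bool (x = y))"

definition apply_op :: "basis_state set \<Rightarrow> operator \<Rightarrow> state \<Rightarrow> state" where
  "apply_op B M \<psi> = (\<lambda>x. \<Sum>y\<in>B. M x y * \<psi> y)"

definition unitary_on :: "basis_state set \<Rightarrow> operator \<Rightarrow> bool" where
  "unitary_on B U \<longleftrightarrow>
     (\<forall>x\<in>B. \<forall>y\<in>B. (\<Sum>z\<in>B. cnj (U z x) * U z y) = of_bool (x = y)) \<and>
     (\<forall>x\<in>B. \<forall>y\<in>B. (\<Sum>z\<in>B. U x z * cnj (U y z)) = of_bool (x = y))"

(* On bits, exclusive or is disequality.  The selector s = False queries A0 and
   s = True queries A1. *)
fun query :: "nat set \<Rightarrow> nat set \<Rightarrow> basis_state \<Rightarrow> basis_state" where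
  "query A0 A1 (s, i, b, z) = (s, i, b \<noteq> (i \<in> (if s then A1 else A0)), z)"

(* The linear operator |y> \<mapsto> |query A0 A1 y>. *)
definition oracle_op :: "nat set \<Rightarrow> nat set \<Rightarrow> operator" where
  "oracle_op A0 A1 = (\<lambda>x y. of_bool (x = query A0 A1 y))"

record query_algorithm =
  workspace_dim :: nat
  queries :: nat
  initial :: basis_state
  unitaries :: "nat \<Rightarrow> operator"
  accepting :: "basis_state set"

(* With T queries the algorithm applies U_T O U_(T-1) O ... U_1 O U_0, where U_t is
   "unitaries Q t" and O is the oracle, to its initial state, and measures in the
   computational basis, accepting if the outcome lies in "accepting Q". *)
definition is_query_algorithm :: "nat \<Rightarrow> query_algorithm \<Rightarrow> bool" where
  "is_query_algorithm N Q \<longleftrightarrow>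
     initial Q \<in> basis N (workspace_dim Q) \<and>
     (\<forall>t\<le>queries Q. unitary_on (basis N (workspace_dim Q)) (unitaries Q t)) \<and>
     accepting Q \<subseteq> basis N (workspace_dim Q)"

fun state_after ::
    "nat \<Rightarrow> query_algorithm \<Rightarrow> nat set \<Rightarrow> nat set \<Rightarrow> nat \<Rightarrow> state" where
  "state_after N Q A0 A1 0 =
     apply_op (basis N (workspace_dim Q)) (unitaries Q 0) (ket (initial Q))"
| "state_after N Q A0 A1 (Suc t) =
     apply_op (basis N (workspace_dim Q)) (unitaries Q (Suc t))
       (apply_op (basis N (workspace_dim Q)) (oracle_op A0 A1) (state_after N Q A0 A1 t))"

definition accept_prob :: "nat \<Rightarrow> query_algorithm \<Rightarrow> nat set \<Rightarrow> nat set \<Rightarrow> real" where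
  "accept_prob N Q A0 A1 =
     (\<Sum>x\<in>accepting Q. (cmod (state_after N Q A0 A1 (queries Q) x))\<^sup>2)"

lemma finite_basis: "finite (basis N m)"
  by (simp add: basis_def)

lemma query_query: "query A0 A1 (query A0 A1 x) = x"
  by (cases x) auto

lemma query_in_basis_iff: "query A0 A1 x \<in> basis N m \<longleftrightarrow> x \<in> basis N m"
  by (cases x) (auto simp: basis_def)

lemma unitary_on_oracle_op: "unitary_on (basis N m) (oracle_op A0 A1)"
proof -
  have eq: "x = query A0 A1 y \<longleftrightarrow> y = query A0 A1 x" for x y
    by (metis query_query)
  have 1: "(\<Sum>z\<in>basis N m. cnj (oracle_op A0 A1 z x) * oracle_op A0 A1 z y) = of_bool (x = y)"
    if "x \<in> basis N m" for x y
  proof -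
    have "(\<Sum>z\<in>basis N m. cnj (oracle_op A0 A1 z x) * oracle_op A0 A1 z y) =
          (\<Sum>z\<in>basis N m. if z = query A0 A1 x then of_bool (x = y) else 0)"
      by (rule sum.cong) (auto simp: oracle_op_def, (metis query_query)+)
    also have "\<dots> = of_bool (x = y)"
      using that by (simp add: finite_basis query_in_basis_iff)
    finally show ?thesis .
  qed
  have 2: "oracle_op A0 A1 x z = oracle_op A0 A1 z x" "cnj (oracle_op A0 A1 x z) = oracle_op A0 A1 x z"
    for x z
    using eq by (auto simp: oracle_op_def)
  show ?thesis
    unfolding unitary_on_def using 1 2 by (metis (no_types, lifting) sum.cong)
qed

lemma apply_op_unitary_norm:
  assumes "finite B" "unitary_on B U"
  shows "(\<Sum>x\<in>B. (cmod (apply_op B U \<psi> x))\<^sup>2) = (\<Sum>x\<in>B. (cmod (\<psi> x))\<^sup>2)"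
proof -
  have "complex_of_real (\<Sum>x\<in>B. (cmod (apply_op B U \<psi> x))\<^sup>2) =
        (\<Sum>x\<in>B. cnj (apply_op B U \<psi> x) * apply_op B U \<psi> x)"
    by (simp add: complex_norm_square mult.commute del: of_real_power)
  also have "\<dots> = (\<Sum>x\<in>B. \<Sum>y\<in>B. \<Sum>z\<in>B. (cnj (\<psi> y) * \<psi> z) * (cnj (U x y) * U x z))"
    by (simp only: apply_op_def cnj_sum sum_product complex_cnj_mult) (simp only: mult_ac)
  also have "\<dots> = (\<Sum>y\<in>B. \<Sum>z\<in>B. \<Sum>x\<in>B. (cnj (\<psi> y) * \<psi> z) * (cnj (U x y) * U x z))"
    by (subst sum.swap, rule sum.cong[OF refl], subst sum.swap, rule refl)
  also have "\<dots> = (\<Sum>y\<in>B. \<Sum>z\<in>B. (cnj (\<psi> y) * \<psi> z) * of_bool (y = z))"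
    using assms(2) by (simp add: sum_distrib_left[symmetric] unitary_on_def)
  also have "\<dots> = (\<Sum>y\<in>B. cnj (\<psi> y) * \<psi> y)"
  proof (rule sum.cong[OF refl])
    fix y assume "y \<in> B"
    have "(\<Sum>z\<in>B. (cnj (\<psi> y) * \<psi> z) * of_bool (y = z)) =
          (\<Sum>z\<in>B. if z = y then cnj (\<psi> y) * \<psi> y else 0)"
      by (rule sum.cong) auto
    then show "(\<Sum>z\<in>B. (cnj (\<psi> y) * \<psi> z) * of_bool (y = z)) = cnj (\<psi> y) * \<psi> y"
      using \<open>y \<in> B\<close> assms(1) by simp
  qed
  also have "\<dots> = complex_of_real (\<Sum>x\<in>B. (cmod (\<psi> x))\<^sup>2)"
    by (simp add: complex_norm_square mult.commute del: of_real_power)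
  finally show ?thesis
    by (simp only: of_real_eq_iff)
qed

lemma state_after_norm:
  assumes "is_query_algorithm N Q" "t \<le> queries Q"
  shows "(\<Sum>x\<in>basis N (workspace_dim Q). (cmod (state_after N Q A0 A1 t x))\<^sup>2) = 1"
  using assms(2)
proof (induction t)
  case 0
  have "(\<Sum>x\<in>basis N (workspace_dim Q). (cmod (ket (initial Q) x))\<^sup>2) =
        (\<Sum>x\<in>basis N (workspace_dim Q). if x = initial Q then 1 else 0)"
    by (rule sum.cong) (auto simp: ket_def)
  also have "\<dots> = 1"
    using assms(1) by (simp add: is_query_algorithm_def finite_basis)
  finally show ?case
    using assms(1) by (simp add: is_query_algorithm_def apply_op_unitary_norm finite_basis)
next
  case (Suc t)
  then show ?case
    using assms(1)
    by (simp add: is_query_algorithm_def apply_op_unitary_norm finite_basis unitary_on_oracle_op)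
qed

lemma accept_prob_bounds:
  assumes "is_query_algorithm N Q"
  shows "0 \<le> accept_prob N Q A0 A1" "accept_prob N Q A0 A1 \<le> 1"
proof -
  show "0 \<le> accept_prob N Q A0 A1"
    by (simp add: accept_prob_def sum_nonneg)
  have "accept_prob N Q A0 A1 \<le>
        (\<Sum>x\<in>basis N (workspace_dim Q). (cmod (state_after N Q A0 A1 (queries Q) x))\<^sup>2)"
    unfolding accept_prob_def using assms
    by (intro sum_mono2) (auto simp: is_query_algorithm_def finite_basis)
  then show "accept_prob N Q A0 A1 \<le> 1"
    using state_after_norm[OF assms] by simp
qed

end

theory Submission
  imports Defs "HOL-Computational_Algebra.Polynomial"
begin

text \<open>
  By the polynomial method, averaging the acceptance probability over all pairs of sets of sizes
  \<open>k\<close> and \<open>l\<close> gives a polynomial \<open>p(k, l)\<close> of degree at most \<open>2T\<close> in each variable.  Suppose \<open>T\<close>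
  were smaller than \<open>min (sqrt w) (sqrt (N / w))\<close> by a large factor.  Since \<open>\<bar>p\<bar> \<le> \<alpha>\<close> at the
  integer points of the two rectangles \<open>[2w, N] \<times> [0, w]\<close> and \<open>[0, w] \<times> [2w, N]\<close>, it is at most
  \<open>(5/4)\<^sup>2 \<alpha>\<close> at their real points.  On the hyperbola \<open>(2ws, 2w/s)\<close>, the symmetrization
  \<open>p(2ws, 2w/s) + p(2w/s, 2ws)\<close> is a polynomial \<open>q\<close> of degree at most \<open>2T\<close> in \<open>s + 1/s\<close>.  It is bounded by
  \<open>25/8 \<alpha>\<close> on \<open>[5/2, N/(2w)]\<close>, an interval of length much larger than \<open>T\<^sup>2\<close>, hence by
  \<open>5/4 \<cdot> 25/8 \<alpha> < 4 \<alpha>\<close> at distance \<open>1/2\<close> from it, whereas \<open>q(2) = 2 p(2w, 2w) \<ge> 4 \<alpha>\<close>.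
\<close>

section \<open>Polynomials bounded at integer points\<close>

lemma lagrange_interpolation:
  fixes P :: "real poly" and x :: "nat \<Rightarrow> real"
  assumes "degree P \<le> d" and "inj_on x {..d}"
  shows "poly P t = (\<Sum>j\<le>d. poly P (x j) * (\<Prod>i\<in>{..d} - {j}. (t - x i) / (x j - x i)))"
proof -
  define L where "L j = (\<Prod>i\<in>{..d} - {j}. smult (1 / (x j - x i)) [:- x i, 1:])" for j
  define Q where "Q = (\<Sum>j\<le>d. smult (poly P (x j)) (L j))"
  have poly_L: "poly (L j) u = (\<Prod>i\<in>{..d} - {j}. (u - x i) / (x j - x i))" for j u
    by (simp add: L_def poly_prod diff_divide_distrib)
  have "degree (L j) \<le> d" if "j \<le> d" for j
  proof -
    have "degree (L j) \<le> (\<Sum>i\<in>{..d} - {j}. degree (smult (1 / (x j - x i)) [:- x i, 1:]))"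
      unfolding L_def by (rule degree_prod_sum_le[unfolded o_def]) simp
    also have "\<dots> \<le> (\<Sum>i\<in>{..d} - {j}. 1)"
      by (intro sum_mono) (auto intro: order_trans[OF degree_smult_le])
    finally show ?thesis
      using that by simp
  qed
  then have "degree Q \<le> d"
    unfolding Q_def by (intro degree_sum_le) (auto intro: order_trans[OF degree_smult_le])
  moreover have "poly Q (x k) = poly P (x k)" if "k \<le> d" for k
  proof -
    have "poly (L j) (x k) = of_bool (j = k)" if "j \<le> d" for j
    proof (cases "j = k")
      case True
      have "x j - x i \<noteq> 0" if "i \<in> {..d} - {j}" for i
        using assms(2) that \<open>j \<le> d\<close> by (auto simp: inj_on_def)
      then have "(\<Prod>i\<in>{..d} - {j}. (x j - x i) / (x j - x i)) = 1"
        by (intro prod.neutral) auto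
      with True show ?thesis
        by (simp add: poly_L)
    next
      case False
      then have "k \<in> {..d} - {j}"
        using \<open>k \<le> d\<close> by auto
      then have "\<exists>i\<in>{..d} - {j}. (x k - x i) / (x j - x i) = 0"
        by (intro bexI[of _ k]) auto
      then show ?thesis
        using False by (simp add: poly_L prod_zero)
    qed
    then have "poly Q (x k) = (\<Sum>j\<le>d. if j = k then poly P (x k) else 0)"
      unfolding Q_def poly_sum by (intro sum.cong) auto
    then show ?thesis
      using that by simp
  qed
  ultimately have "Q = P"
    using assms by (intro poly_eqI_degree[of "x ` {..d}"]) (auto simp: card_image)
  then show ?thesis
    by (metis (no_types, lifting) Q_def poly_L poly_sum poly_smult sum.cong)
qed

text \<open>Since \<open>j\<^sup>2 - i\<^sup>2 = (j - i) (j + i)\<close>, both factors of the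
  denominator telescope into quotients of factorials. The case \<open>n = j - 1\<close> supplies the
  nodes below \<open>j\<close> in the full product.\<close>

lemma prod_square_ratio_below:
  fixes n j :: nat
  assumes "n < j"
  shows "(\<Prod>i\<in>{1..n}. (real i)\<^sup>2 / \<bar>(real j)\<^sup>2 - (real i)\<^sup>2\<bar>) =
    (fact n)\<^sup>2 * fact (j - 1 - n) * fact j / (fact (j - 1) * fact (j + n))"
  using assms
proof (induction n)
  case 0
  then show ?case by simp
next
  case (Suc n)
  define k where "k = j - 2 - n"
  have j: "j = Suc (Suc (n + k))"
    using Suc.prems by (simp add: k_def)
  have "\<bar>(real j)\<^sup>2 - (real (Suc n))\<^sup>2\<bar> = (real k + 1) * (real j + real n + 1)"
    unfolding j by (simp add: power2_eq_square algebra_simps)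
  moreover have "(fact (j - 1 - n) :: real) = (real k + 1) * fact k" "j - 1 - Suc n = k"
    "(fact (j + Suc n) :: real) = (real j + real n + 1) * fact (j + n)"
    unfolding j by (simp_all add: algebra_simps)
  moreover have "{1..Suc n} = insert (Suc n) {1..n}"
    by auto
  \<comment> \<open>The regrouping is proved for arbitrary reals and then instantiated, so that the
    factorials stay opaque to the simplifier.\<close>
  moreover have "A\<^sup>2 / (b * c) * (F\<^sup>2 * (b * g) * h / (p * q)) = (A * F)\<^sup>2 * g * h / (p * (c * q))"
    if "b \<noteq> 0" for A F b c g h p q :: real
    using that by (simp add: power_mult_distrib mult_ac)
  note this[of "real k + 1" "real (Suc n)" "real j + real n + 1" "fact n" "fact k" "fact j"
    "fact (j - 1)" "fact (j + n)"]
  moreover have "real k + 1 \<noteq> 0"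
    by linarith
  moreover have "(\<Prod>i\<in>{1..n}. (real i)\<^sup>2 / \<bar>(real j)\<^sup>2 - (real i)\<^sup>2\<bar>) =
    (fact n)\<^sup>2 * fact (j - 1 - n) * fact j / (fact (j - 1) * fact (j + n))"
    using Suc by simp
  ultimately show ?case
    by (simp only: prod.insert finite_atLeastAtMost fact_Suc) simp
qed

text \<open>Induction starts at \<open>d = j\<close>, where only nodes below \<open>j\<close> occur,
  and then adds the nodes above \<open>j\<close> one at a time. The closed form is twice the ratio
  of the binomial coefficients of \<open>2d\<close> over \<open>d - j\<close> and over
  \<open>d\<close>.\<close>

lemma prod_square_ratio:
  fixes d j :: nat
  assumes "1 \<le> j" "j \<le> d"
  shows "(\<Prod>i\<in>{1..d} - {j}. (real i)\<^sup>2 / \<bar>(real j)\<^sup>2 - (real i)\<^sup>2\<bar>) =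
    2 * (fact d)\<^sup>2 / (fact (d - j) * fact (d + j))"
  using assms(2)
proof (induction d rule: dec_induct)
  case base
  obtain n where j: "j = Suc n"
    using assms(1) by (cases j) auto
  have "{1..j} - {j} = {1..n}"
    unfolding j by auto
  moreover have "(fact (j + j) :: real) = 2 * real j * fact (j + n)"
    unfolding j by (simp add: algebra_simps)
  moreover have "(fact j :: real) = real j * fact n"
    unfolding j by simp
  moreover have "real j \<noteq> 0"
    unfolding j by simp
  moreover have "F\<^sup>2 * 1 * (x * F) / (F * q) = 2 * (x * F)\<^sup>2 / (1 * (2 * x * q))"
    if "x \<noteq> 0" "F \<noteq> 0" for F x q :: real
    using that by (simp add: power2_eq_square)
  note this[of "real j" "fact n" "fact (j + n)"]
  ultimately show ?case
    using prod_square_ratio_below[of n j] j by simp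
next
  case (step n)
  define k where "k = n - j"
  have n: "n = j + k"
    using step by (simp add: k_def)
  have "{1..Suc n} - {j} = insert (Suc n) ({1..n} - {j})"
    using step by auto
  moreover have "(real j)\<^sup>2 - (real (Suc n))\<^sup>2 = - ((real k + 1) * (real n + real j + 1))"
    unfolding n by (simp add: power2_eq_square algebra_simps)
  then have "\<bar>(real j)\<^sup>2 - (real (Suc n))\<^sup>2\<bar> = (real k + 1) * (real n + real j + 1)"
    by (simp only: abs_minus_cancel) (simp only: abs_of_nonneg mult_nonneg_nonneg add_nonneg_nonneg of_nat_0_le_iff zero_le_one)
  moreover have "(fact (Suc n - j) :: real) = (real k + 1) * fact (n - j)"
    "(fact (Suc n + j) :: real) = (real n + real j + 1) * fact (n + j)"
    unfolding n by (simp_all add: algebra_simps)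
  moreover have "A\<^sup>2 / (b * c) * (2 * F\<^sup>2 / (p * q)) = 2 * (A * F)\<^sup>2 / ((b * p) * (c * q))"
    for A F b c p q :: real
    by (simp add: power_mult_distrib mult_ac)
  note this[of "real (Suc n)" "real k + 1" "real n + real j + 1" "fact n" "fact (n - j)" "fact (n + j)"]
  ultimately show ?case
    using step.IH by simp
qed

text \<open>This says that the central binomial coefficient is the largest: passing from
  \<open>j\<close> to \<open>j + 1\<close> multiplies the right side by
  \<open>(d + j + 1) / (d - j)\<close>, which is at least 1.\<close>

lemma fact_square_le: "(fact d)\<^sup>2 \<le> (fact (d - j) * fact (d + j) :: real)" if "j \<le> d"
  using that
proof (induction j)
  case 0
  then show ?case by (simp add: power2_eq_square)
next
  case (Suc j)
  define k where "k = d - Suc j"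
  have "d - j = Suc k" "d - Suc j = k"
    using Suc.prems by (auto simp: k_def)
  moreover have "real (Suc k) \<le> real (Suc (d + j))"
    by (simp add: k_def)
  then have "real (Suc k) * (fact k * fact (d + j)) \<le> real (Suc (d + j)) * (fact k * fact (d + j))"
    by (intro mult_right_mono) auto
  moreover have "(fact (Suc k) :: real) = real (Suc k) * fact k"
    "(fact (d + Suc j) :: real) = real (Suc (d + j)) * fact (d + j)"
    by simp_all
  moreover have "(fact d)\<^sup>2 \<le> (fact (d - j) * fact (d + j) :: real)"
    using Suc by simp
  ultimately show ?case
    by (simp only: mult_ac)
qed

lemma prod_square_ratio_le_2:
  fixes d j :: nat
  assumes "1 \<le> j" "j \<le> d"
  shows "(\<Prod>i\<in>{1..d} - {j}. (real i)\<^sup>2 / \<bar>(real j)\<^sup>2 - (real i)\<^sup>2\<bar>) \<le> 2"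
  unfolding prod_square_ratio[OF assms] using fact_square_le[OF assms(2)]
  by (simp add: divide_le_eq)

lemma sum_inverse_squares_le: "(\<Sum>i\<in>{1..d}. 1 / (real i)\<^sup>2) \<le> 2"
proof -
  \<comment> \<open>The correction \<open>1 / Suc n\<close> makes the induction go through by
    telescoping.\<close>
  have "(\<Sum>i\<in>{1..Suc n}. 1 / (real i)\<^sup>2) \<le> 2 - 1 / real (Suc n)" for n
  proof (induction n)
    case (Suc n)
    have "1 / (real (Suc (Suc n)))\<^sup>2 \<le> 1 / (real (Suc n) * real (Suc (Suc n)))"
      unfolding power2_eq_square by (intro divide_left_mono mult_right_mono) auto
    also have "\<dots> = 1 / real (Suc n) - 1 / real (Suc (Suc n))"
      by (simp add: field_simps)
    finally show ?case
      using Suc by (simp add: atLeastAtMostSuc_conv)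
  qed auto
  from order_trans[OF this] show ?thesis
    by (cases d) (simp_all del: sum.cl_ivl_Suc)
qed

lemma prod_one_plus_le:
  assumes "A \<subseteq> {1..d}" "0 \<le> e" "e \<le> 1 / 40"
  shows "(\<Prod>i\<in>A. 1 + e / (real i)\<^sup>2) \<le> 20 / 19"
proof -
  have "(\<Prod>i\<in>A. 1 + e / (real i)\<^sup>2) \<le> (\<Prod>i\<in>A. exp (e / (real i)\<^sup>2))"
    using assms by (intro prod_mono) (auto intro: add_nonneg_nonneg)
  also have "\<dots> = exp (e * (\<Sum>i\<in>A. 1 / (real i)\<^sup>2))"
    using finite_subset[OF assms(1)] by (simp add: exp_sum sum_distrib_left)
  also have "\<dots> \<le> exp (1 / 20)"
  proof -
    have "(\<Sum>i\<in>A. 1 / (real i)\<^sup>2) \<le> (\<Sum>i\<in>{1..d}. 1 / (real i)\<^sup>2)"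
      using assms(1) by (intro sum_mono2) auto
    then have "e * (\<Sum>i\<in>A. 1 / (real i)\<^sup>2) \<le> 1 / 40 * 2"
      using assms sum_inverse_squares_le[of d] by (intro mult_mono) (auto intro: sum_nonneg)
    then show ?thesis by simp
  qed
  also have "\<dots> \<le> 20 / 19"
    \<comment> \<open>Here \<open>exp (- 1 / 20)\<close> is at least \<open>19 / 20\<close>, and the
      bound follows by inversion.\<close>
    using exp_ge_add_one_self[of "- 1 / 20 :: real"] by (simp add: exp_minus field_simps)
  finally show ?thesis .
qed

text \<open>Square nodes make the Lagrange weights at a point just outside the node range summable:
  the weight of node \<open>j \<ge> 1\<close> is at most a constant over \<open>j\<^sup>2\<close>, uniformly in the degree.\<close>

lemma square_nodes_bound:
  fixes P :: "real poly"
  assumes deg: "degree P \<le> d"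
    and bound: "\<And>j. j \<le> d \<Longrightarrow> \<bar>poly P (a + 40 * (real j)\<^sup>2)\<bar> \<le> B"
    and \<delta>: "0 \<le> \<delta>" "\<delta> \<le> 1"
  shows "\<bar>poly P (a - \<delta>)\<bar> \<le> 5 / 4 * B"
proof -
  \<comment> \<open>Dividing all differences by the node scale 40 turns the distance from the
    evaluation point to node \<open>i\<close> into \<open>i\<^sup>2 + e\<close>.\<close>
  define e where "e = \<delta> / 40"
  have e: "0 \<le> e" "e \<le> 1 / 40"
    using \<delta> by (auto simp: e_def)
  have B: "0 \<le> B"
    using bound[of 0] by simp
  define x where "x j = a + 40 * (real j)\<^sup>2" for j :: nat
  define W where "W j = (\<Prod>i\<in>{..d} - {j}. (a - \<delta> - x i) / (x j - x i))" for j
  have "inj_on x {..d}"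
    by (auto simp: inj_on_def x_def)
  have factor: "\<bar>(a - \<delta> - x i) / (x j - x i)\<bar> = ((real i)\<^sup>2 + e) / \<bar>(real j)\<^sup>2 - (real i)\<^sup>2\<bar>" for i j
  proof -
    have "a - \<delta> - x i = - (40 * ((real i)\<^sup>2 + e))"
      by (simp add: x_def e_def)
    moreover have "x j - x i = 40 * ((real j)\<^sup>2 - (real i)\<^sup>2)"
      by (simp add: x_def)
    ultimately show ?thesis
      using e by (simp only: abs_divide abs_mult abs_minus_cancel mult_divide_mult_cancel_left_if) simp
  qed
  have absW: "\<bar>W j\<bar> = (\<Prod>i\<in>{..d} - {j}. ((real i)\<^sup>2 + e) / \<bar>(real j)\<^sup>2 - (real i)\<^sup>2\<bar>)" for j
    by (simp only: W_def abs_prod factor)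
  have W0: "\<bar>W 0\<bar> \<le> 20 / 19"
  proof -
    have "\<bar>W 0\<bar> = (\<Prod>i\<in>{1..d}. 1 + e / (real i)\<^sup>2)"
      unfolding absW by (intro prod.cong) (auto simp: field_simps)
    then show ?thesis
      using prod_one_plus_le[OF subset_refl e] by simp
  qed
  \<comment> \<open>The node \<open>i = 0\<close> contributes the factor
    \<open>e / j\<^sup>2\<close>, which makes the weights summable. The other nodes contribute at
    most \<open>2 * (20 / 19)\<close>, and \<open>1/40 * 2 * 20/19 = 1/19\<close>.\<close>
  have Wj: "\<bar>W j\<bar> \<le> 1 / 19 * (1 / (real j)\<^sup>2)" if j: "j \<in> {1..d}" for j
  proof -
    have "{..d} - {j} = insert 0 ({1..d} - {j})"
      using j by auto
    then have "\<bar>W j\<bar> = e / (real j)\<^sup>2 *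
        (\<Prod>i\<in>{1..d} - {j}. ((real i)\<^sup>2 + e) / \<bar>(real j)\<^sup>2 - (real i)\<^sup>2\<bar>)"
      by (simp add: absW)
    also have "(\<Prod>i\<in>{1..d} - {j}. ((real i)\<^sup>2 + e) / \<bar>(real j)\<^sup>2 - (real i)\<^sup>2\<bar>) =
        (\<Prod>i\<in>{1..d} - {j}. (real i)\<^sup>2 / \<bar>(real j)\<^sup>2 - (real i)\<^sup>2\<bar>) *
        (\<Prod>i\<in>{1..d} - {j}. 1 + e / (real i)\<^sup>2)"
      unfolding prod.distrib[symmetric] by (intro prod.cong) (auto simp: distrib_left add_divide_distrib)
    also have "e / (real j)\<^sup>2 * \<dots> \<le> (1 / 40) / (real j)\<^sup>2 * (2 * (20 / 19))"
      using e j prod_square_ratio_le_2[of j d] prod_one_plus_le[of "{1..d} - {j}" d e]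
      by (intro mult_mono divide_right_mono mult_nonneg_nonneg prod_nonneg) auto
    finally show ?thesis by simp
  qed
  have "\<bar>poly P (a - \<delta>)\<bar> = \<bar>\<Sum>j\<le>d. poly P (x j) * W j\<bar>"
    unfolding W_def by (subst lagrange_interpolation[OF deg \<open>inj_on x {..d}\<close>]) simp
  also have "\<dots> \<le> (\<Sum>j\<le>d. B * \<bar>W j\<bar>)"
    using bound by (intro order_trans[OF sum_abs] sum_mono) (auto simp: abs_mult x_def intro: mult_right_mono)
  also have "\<dots> = B * (\<bar>W 0\<bar> + (\<Sum>j\<in>{1..d}. \<bar>W j\<bar>))"
  proof -
    have "{..d} = insert 0 {1..d}" by auto
    then show ?thesis by (simp add: sum_distrib_left distrib_left)
  qed
  \<comment> \<open>The total weight \<open>22 / 19\<close> is below \<open>5 / 4\<close>.\<close>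
  also have "\<dots> \<le> B * (20 / 19 + 1 / 19 * 2)"
  proof -
    have "(\<Sum>j\<in>{1..d}. \<bar>W j\<bar>) \<le> (\<Sum>j\<in>{1..d}. 1 / 19 * (1 / (real j)\<^sup>2))"
      by (intro sum_mono Wj)
    also have "\<dots> \<le> 1 / 19 * 2"
      unfolding sum_distrib_left[symmetric] using sum_inverse_squares_le[of d] by simp
    finally show ?thesis
      using B W0 by (intro mult_left_mono) auto
  qed
  also have "\<dots> \<le> 5 / 4 * B"
    using B by simp
  finally show ?thesis .
qed

section \<open>From integer points to real points\<close>

lemma integer_bound_lower_half:
  fixes P :: "real poly" and m n :: int
  assumes "degree P \<le> d"
    and "\<And>k::int. m \<le> k \<Longrightarrow> k \<le> n \<Longrightarrow> \<bar>poly P (of_int k)\<bar> \<le> B"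
    and "of_int m \<le> x" "x + 40 * (real d)\<^sup>2 + 1 \<le> of_int n"
  shows "\<bar>poly P x\<bar> \<le> 5 / 4 * B"
proof -
  \<comment> \<open>Starting the square nodes at the ceiling of \<open>x\<close> makes them all
    integers and puts \<open>x\<close> at distance less than 1 to the left of the first. The summand
    1 in the room required on the right pays for the rounding.\<close>
  have "\<bar>poly P (of_int \<lceil>x\<rceil> + 40 * (real j)\<^sup>2)\<bar> \<le> B" if "j \<le> d" for j
  proof -
    have "(real j)\<^sup>2 \<le> (real d)\<^sup>2"
      using that by (simp add: power_mono)
    then have "real_of_int (\<lceil>x\<rceil> + 40 * (int j)\<^sup>2) \<le> of_int n"
      using assms(4) ceiling_correct[of x] unfolding of_int_add of_int_mult of_int_power of_int_of_nat_eq of_int_numeral by linarith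
    then have "\<lceil>x\<rceil> + 40 * (int j)\<^sup>2 \<le> n"
      by (simp only: of_int_le_iff)
    moreover have "m \<le> \<lceil>x\<rceil> + 40 * (int j)\<^sup>2"
    proof -
      have "m \<le> \<lceil>x\<rceil>" using assms(3) by linarith
      then show ?thesis by (simp add: add_increasing2)
    qed
    ultimately show ?thesis
      using assms(2)[of "\<lceil>x\<rceil> + 40 * (int j)\<^sup>2"] by simp
  qed
  from square_nodes_bound[OF assms(1) this, of "of_int \<lceil>x\<rceil> - x"] show ?thesis
    by simp linarith
qed

text \<open>An interval of this length has enough room for the square nodes on at least one side of
  \<open>x\<close>. If the room is on the left, the reflection of \<open>P\<close> reduces to the
  other case.\<close>

lemma integer_bound:
  fixes P :: "real poly" and m n :: int
  assumes deg: "degree P \<le> d"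
    and bound: "\<And>k::int. m \<le> k \<Longrightarrow> k \<le> n \<Longrightarrow> \<bar>poly P (of_int k)\<bar> \<le> B"
    and length: "2 * (40 * (real d)\<^sup>2 + 1) \<le> of_int n - of_int m"
    and x: "of_int m \<le> x" "x \<le> of_int n"
  shows "\<bar>poly P x\<bar> \<le> 5 / 4 * B"
proof (cases "x + 40 * (real d)\<^sup>2 + 1 \<le> of_int n")
  case True
  with integer_bound_lower_half[OF deg bound x(1)] show ?thesis by blast
next
  case False
  define P' where "P' = pcompose P [:0, -1:]"
  have poly_P': "poly P' u = poly P (- u)" for u
    by (simp add: P'_def poly_pcompose)
  have "\<bar>poly P' (- x)\<bar> \<le> 5 / 4 * B"
  proof (rule integer_bound_lower_half)
    show "degree P' \<le> d"
      using deg by (simp add: P'_def degree_pcompose)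
    show "\<bar>poly P' (of_int k)\<bar> \<le> B" if "- n \<le> k" "k \<le> - m" for k
      using bound[of "- k"] that by (simp add: poly_P')
    show "of_int (- n) \<le> - x" "- x + 40 * (real d)\<^sup>2 + 1 \<le> of_int (- m)"
      using False x length by simp_all
  qed
  then show ?thesis
    by (simp add: poly_P')
qed

section \<open>Symmetrization of bivariate polynomials\<close>

text \<open>These are rescaled Chebyshev polynomials: with \<open>u = s + 1 / s\<close>, the
  recurrence \<open>D_(k+2) = u D_(k+1) - D_k\<close> holds.\<close>

lemma power_plus_reciprocal_power_poly:
  "\<exists>D::real poly. degree D \<le> k \<and> (\<forall>s. s \<noteq> 0 \<longrightarrow> poly D (s + 1 / s) = s ^ k + (1 / s) ^ k)"
proof (induction k rule: induct_nat_012)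
  case 0
  show ?case by (intro exI[of _ "[:2:]"]) simp
next
  case 1
  show ?case by (intro exI[of _ "[:0, 1:]"]) simp
next
  case (ge2 k)
  then obtain D E :: "real poly" where D: "degree D \<le> k" "degree E \<le> Suc k"
    "\<And>s. s \<noteq> 0 \<Longrightarrow> poly D (s + 1 / s) = s ^ k + (1 / s) ^ k"
    "\<And>s. s \<noteq> 0 \<Longrightarrow> poly E (s + 1 / s) = s ^ Suc k + (1 / s) ^ Suc k"
    by blast
  have "degree (pCons 0 E - D) \<le> Suc (Suc k)"
    using D(1,2) by (intro degree_diff_le) (auto simp: degree_pCons_eq_if)
  moreover have "poly (pCons 0 E - D) (s + 1 / s) = s ^ Suc (Suc k) + (1 / s) ^ Suc (Suc k)"
    if "s \<noteq> 0" for s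
  proof -
    have "poly (pCons 0 E - D) (s + 1 / s) =
        (s + 1 / s) * (s ^ Suc k + (1 / s) ^ Suc k) - (s ^ k + (1 / s) ^ k)"
      by (simp only: poly_diff poly_pCons D(3,4)[OF that] add_0)
    also have "\<dots> = s ^ Suc (Suc k) + (1 / s) ^ Suc (Suc k)"
      using that by (simp add: field_simps)
    finally show ?thesis .
  qed
  ultimately show ?case by blast
qed

text \<open>On the hyperbola the common power of \<open>s\<close> and \<open>1 / s\<close> cancels,
  leaving \<open>r ^ (i + j)\<close> times the sum of the powers of \<open>s\<close> and
  \<open>1 / s\<close> with exponent \<bar>i - j\<bar>. The degree is therefore bounded by
  \<open>d\<close> and not by \<open>i + j\<close>.\<close>

lemma symmetrized_monomial_poly:
  assumes "i \<le> d" "j \<le> d"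
  shows "\<exists>D::real poly. degree D \<le> d \<and>
    (\<forall>s. s \<noteq> 0 \<longrightarrow> (r * s) ^ i * (r / s) ^ j + (r / s) ^ i * (r * s) ^ j = poly D (s + 1 / s))"
proof -
  have *: "\<exists>D::real poly. degree D \<le> d \<and>
    (\<forall>s. s \<noteq> 0 \<longrightarrow> (r * s) ^ (j + k) * (r / s) ^ j + (r / s) ^ (j + k) * (r * s) ^ j = poly D (s + 1 / s))"
    if "j + k \<le> d" for j k
  proof -
    obtain D :: "real poly" where "degree D \<le> k"
      "\<And>s. s \<noteq> 0 \<Longrightarrow> poly D (s + 1 / s) = s ^ k + (1 / s) ^ k"
      using power_plus_reciprocal_power_poly by blast
    moreover have "(r * s) ^ (j + k) * (r / s) ^ j + (r / s) ^ (j + k) * (r * s) ^ j =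
        (r ^ j * r ^ (j + k)) * (s ^ k + (1 / s) ^ k)" if "s \<noteq> 0" for s :: real
      using that by (simp add: power_add power_mult_distrib power_divide field_simps)
    ultimately show ?thesis
      using that by (intro exI[of _ "smult (r ^ j * r ^ (j + k)) D"])
        (auto intro: order_trans[OF degree_smult_le])
  qed
  show ?thesis
  proof (cases "j \<le> i")
    case True
    with *[of j "i - j"] assms show ?thesis by simp
  next
    case False
    with *[of i "j - i"] assms show ?thesis by (simp add: add.commute mult.commute)
  qed
qed

section \<open>Functions polynomial in each of two variables\<close>

definition bipoly :: "nat \<Rightarrow> (real \<Rightarrow> real \<Rightarrow> real) \<Rightarrow> bool" where
  "bipoly d f \<longleftrightarrow> (\<exists>c. \<forall>x y. f x y = (\<Sum>i\<le>d. \<Sum>j\<le>d. c i j * (x ^ i * y ^ j)))"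

lemma bipoly_zero: "bipoly d (\<lambda>x y. 0)"
  unfolding bipoly_def by (intro exI[of _ "\<lambda>i j. 0"]) simp

lemma bipoly_add:
  assumes "bipoly d f" "bipoly d g"
  shows "bipoly d (\<lambda>x y. f x y + g x y)"
proof -
  obtain a b where "\<And>x y. f x y = (\<Sum>i\<le>d. \<Sum>j\<le>d. a i j * (x ^ i * y ^ j))"
    "\<And>x y. g x y = (\<Sum>i\<le>d. \<Sum>j\<le>d. b i j * (x ^ i * y ^ j))"
    using assms unfolding bipoly_def by blast
  then show ?thesis
    unfolding bipoly_def
    by (intro exI[of _ "\<lambda>i j. a i j + b i j"]) (simp add: distrib_right sum.distrib)
qed

lemma bipoly_mult_polys:
  assumes "degree p \<le> d" "degree q \<le> d"
  shows "bipoly d (\<lambda>x y. poly p x * poly q y)"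
proof -
  have *: "poly p x = (\<Sum>i\<le>d. coeff p i * x ^ i)" if "degree p \<le> d" for p :: "real poly" and x
    by (subst poly_as_sum_of_monoms'[OF that, symmetric]) (simp add: poly_sum poly_monom)
  show ?thesis
    unfolding bipoly_def *[OF assms(1)] *[OF assms(2)]
    by (intro exI[of _ "\<lambda>i j. coeff p i * coeff q j"]) (simp add: sum_product mult_ac)
qed

lemma bipoly_swap: "bipoly d f \<Longrightarrow> bipoly d (\<lambda>x y. f y x)"
  unfolding bipoly_def
proof (elim exE)
  fix c
  assume c: "\<forall>x y. f x y = (\<Sum>i\<le>d. \<Sum>j\<le>d. c i j * (x ^ i * y ^ j))"
  have "f y x = (\<Sum>i\<le>d. \<Sum>j\<le>d. c j i * (x ^ i * y ^ j))" for x y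
    unfolding c[rule_format] by (subst sum.swap) (simp add: mult_ac)
  then show "\<exists>c. \<forall>x y. f y x = (\<Sum>i\<le>d. \<Sum>j\<le>d. c i j * (x ^ i * y ^ j))"
    by (intro exI[of _ "\<lambda>i j. c j i"]) simp
qed

lemma bipoly_section:
  assumes "bipoly d f"
  shows "\<exists>P. degree P \<le> d \<and> (\<forall>x. poly P x = f x y)"
proof -
  obtain c where c: "\<And>x y. f x y = (\<Sum>i\<le>d. \<Sum>j\<le>d. c i j * (x ^ i * y ^ j))"
    using assms unfolding bipoly_def by blast
  show ?thesis
    by (intro exI[of _ "\<Sum>i\<le>d. monom (\<Sum>j\<le>d. c i j * y ^ j) i"])
      (auto simp: c poly_sum poly_monom sum_distrib_left mult_ac
        intro!: degree_sum_le order_trans[OF degree_monom_le])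
qed

lemma bipoly_symmetrized:
  assumes "bipoly d f"
  shows "\<exists>D. degree D \<le> d \<and>
    (\<forall>s. s \<noteq> 0 \<longrightarrow> f (r * s) (r / s) + f (r / s) (r * s) = poly D (s + 1 / s))"
proof -
  obtain c where c: "\<And>x y. f x y = (\<Sum>i\<le>d. \<Sum>j\<le>d. c i j * (x ^ i * y ^ j))"
    using assms unfolding bipoly_def by blast
  have "\<forall>i j. \<exists>D. i \<le> d \<longrightarrow> j \<le> d \<longrightarrow> degree D \<le> d \<and>
    (\<forall>s. s \<noteq> 0 \<longrightarrow> (r * s) ^ i * (r / s) ^ j + (r / s) ^ i * (r * s) ^ j = poly D (s + 1 / s))"
    using symmetrized_monomial_poly by blast
  then obtain D where D: "\<And>i j. i \<le> d \<Longrightarrow> j \<le> d \<Longrightarrow> degree (D i j) \<le> d"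
    "\<And>i j s. i \<le> d \<Longrightarrow> j \<le> d \<Longrightarrow> s \<noteq> 0 \<Longrightarrow>
      (r * s) ^ i * (r / s) ^ j + (r / s) ^ i * (r * s) ^ j = poly (D i j) (s + 1 / s)"
    by metis
  define E where "E = (\<Sum>i\<le>d. \<Sum>j\<le>d. smult (c i j) (D i j))"
  have "degree E \<le> d"
    unfolding E_def
    by (intro degree_sum_le) (auto intro!: order_trans[OF degree_smult_le] D)
  moreover have "f (r * s) (r / s) + f (r / s) (r * s) = poly E (s + 1 / s)" if "s \<noteq> 0" for s
    unfolding c E_def poly_sum poly_smult sum.distrib[symmetric] distrib_left[symmetric]
    using that by (intro sum.cong refl) (simp add: D(2))
  ultimately show ?thesis by blast
qed

text \<open>The univariate bound is applied twice: along each integer \<open>k\<close> to reach a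
  real \<open>y\<close>, then along the line of that \<open>y\<close> to reach a real
  \<open>x\<close>. Each pass costs a factor \<open>5 / 4\<close>.\<close>

lemma bipoly_grid_bound:
  fixes m1 n1 m2 n2 :: int
  assumes f: "bipoly d f"
    and bound: "\<And>k l::int. m1 \<le> k \<Longrightarrow> k \<le> n1 \<Longrightarrow> m2 \<le> l \<Longrightarrow> l \<le> n2 \<Longrightarrow>
      \<bar>f (of_int k) (of_int l)\<bar> \<le> B"
    and "2 * (40 * (real d)\<^sup>2 + 1) \<le> of_int n1 - of_int m1"
    and "2 * (40 * (real d)\<^sup>2 + 1) \<le> of_int n2 - of_int m2"
    and x: "of_int m1 \<le> x" "x \<le> of_int n1" and y: "of_int m2 \<le> y" "y \<le> of_int n2"
  shows "\<bar>f x y\<bar> \<le> 25 / 16 * B"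
proof -
  have *: "\<bar>f (of_int k) y\<bar> \<le> 5 / 4 * B" if "m1 \<le> k" "k \<le> n1" for k :: int
  proof -
    obtain P where P: "degree P \<le> d" "\<And>y. poly P y = f (of_int k) y"
      using bipoly_section[OF bipoly_swap[OF f]] by blast
    then show ?thesis
      using integer_bound[OF P(1) _ assms(4) y, of B] bound that by simp
  qed
  obtain P where P: "degree P \<le> d" "\<And>x. poly P x = f x y"
    using bipoly_section[OF f] by blast
  then show ?thesis
    using integer_bound[OF P(1) _ assms(3) x, of "5 / 4 * B"] * by simp
qed

text \<open>The first two lengths let the grid bound cover the rectangle
  \<open>[2w, N] \<times> [0, w]\<close>. The third keeps the square nodes that start at
  \<open>5 / 2\<close> inside the range where \<open>q\<close> is known to be small.\<close>

lemma bipoly_no_separation: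
  fixes w N :: nat
  assumes f: "bipoly d f" and w: "0 < w" and \<alpha>: "0 < \<alpha>"
    and small: "\<And>k l. 2 * w \<le> k \<Longrightarrow> k \<le> N \<Longrightarrow> l \<le> w \<Longrightarrow>
      \<bar>f (real k) (real l)\<bar> \<le> \<alpha> \<and> \<bar>f (real l) (real k)\<bar> \<le> \<alpha>"
    and large: "2 * \<alpha> \<le> f (2 * real w) (2 * real w)"
    and lengths: "2 * (40 * (real d)\<^sup>2 + 1) \<le> real w" "2 * (40 * (real d)\<^sup>2 + 1) \<le> real N - 2 * real w"
      "5 / 2 + 40 * (real d)\<^sup>2 \<le> real N / (2 * real w)"
  shows False
proof -
  have bound: "\<bar>g x y\<bar> \<le> 25 / 16 * \<alpha>"
    if g: "bipoly d g" "\<And>k l. 2 * w \<le> k \<Longrightarrow> k \<le> N \<Longrightarrow> l \<le> w \<Longrightarrow> \<bar>g (real k) (real l)\<bar> \<le> \<alpha>"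
      and xy: "2 * real w \<le> x" "x \<le> real N" "0 \<le> y" "y \<le> real w" for g x y
  proof (rule bipoly_grid_bound[OF g(1), of "2 * int w" "int N" 0 "int w"])
    show "\<bar>g (of_int k) (of_int l)\<bar> \<le> \<alpha>"
      if "2 * int w \<le> k" "k \<le> int N" "0 \<le> l" "l \<le> int w" for k l
    proof -
      have "k = int (nat k)" "l = int (nat l)" "2 * w \<le> nat k" "nat k \<le> N" "nat l \<le> w"
        using that by auto
      with g(2)[of "nat k" "nat l"] show ?thesis
        by (metis of_int_of_nat_eq)
    qed
  qed (use xy lengths in simp_all)
  obtain q where q: "degree q \<le> d"
    "\<And>s. s \<noteq> 0 \<Longrightarrow> f (2 * real w * s) (2 * real w / s) + f (2 * real w / s) (2 * real w * s) = poly q (s + 1 / s)"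
    using bipoly_symmetrized[OF f, of "2 * real w"] by blast
  have q_bound: "\<bar>poly q u\<bar> \<le> 25 / 8 * \<alpha>" if u: "5 / 2 \<le> u" "u \<le> real N / (2 * real w)" for u
  proof -
    \<comment> \<open>This is the larger root of \<open>s + 1 / s = u\<close>. From
      \<open>u \<ge> 5 / 2\<close> follows \<open>s \<ge> 2\<close>, so that
      \<open>2w / s \<le> w\<close>; from \<open>s \<le> u\<close> follows
      \<open>2ws \<le> N\<close>.\<close>
    define s where "s = (u + sqrt (u\<^sup>2 - 4)) / 2"
    have "(5 / 2)\<^sup>2 \<le> u\<^sup>2"
      using u(1) by (intro power_mono) auto
    then have u2: "(3 / 2)\<^sup>2 \<le> u\<^sup>2 - 4"
      by (simp add: power2_eq_square)
    then have "3 / 2 \<le> sqrt (u\<^sup>2 - 4)"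
      by (rule real_le_rsqrt)
    moreover have "sqrt (u\<^sup>2 - 4) \<le> u"
      using u by (intro real_le_lsqrt) auto
    ultimately have s: "2 \<le> s" "s \<le> u"
      using u by (simp_all add: s_def)
    have "(sqrt (u\<^sup>2 - 4))\<^sup>2 = u\<^sup>2 - 4"
      using u2 by (intro real_sqrt_pow2) (simp add: power2_eq_square)
    then have "s * s + 1 = u * s"
      by (simp add: s_def power2_eq_square field_simps)
    then have us: "s + 1 / s = u"
      using s by (simp add: field_simps)
    have "2 * real w * s \<le> real N"
    proof -
      have "s \<le> real N / (2 * real w)"
        using s(2) u(2) by linarith
      then show ?thesis
        using w by (simp add: field_simps)
    qed
    moreover have "2 * real w \<le> 2 * real w * s" "0 \<le> 2 * real w / s" "2 * real w / s \<le> real w"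
      using s(1) w by (simp_all add: field_simps)
    ultimately have "\<bar>f (2 * real w * s) (2 * real w / s)\<bar> \<le> 25 / 16 * \<alpha>"
      "\<bar>f (2 * real w / s) (2 * real w * s)\<bar> \<le> 25 / 16 * \<alpha>"
      using bound[OF f] bound[OF bipoly_swap[OF f]] small by blast+
    moreover have "f (2 * real w * s) (2 * real w / s) + f (2 * real w / s) (2 * real w * s) = poly q u"
      using q(2)[of s] s(1) us by simp
    ultimately show ?thesis by linarith
  qed
  \<comment> \<open>The point 2 belongs to \<open>s = 1\<close>, the corner \<open>(2w, 2w)\<close>.
    The contradiction is \<open>5/4 * 25/8 = 125/32 < 4\<close>.\<close>
  have "\<bar>poly q (5 / 2 - 1 / 2)\<bar> \<le> 5 / 4 * (25 / 8 * \<alpha>)"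
  proof (rule square_nodes_bound[OF q(1) q_bound])
    fix j assume "j \<le> d"
    then have "(real j)\<^sup>2 \<le> (real d)\<^sup>2"
      by (intro power_mono) auto
    then show "5 / 2 + 40 * (real j)\<^sup>2 \<le> real N / (2 * real w)"
      using lengths(3) by linarith
  qed auto
  moreover have "4 * \<alpha> \<le> poly q 2"
    using q(2)[of 1] large by simp
  ultimately show False
    using \<alpha> by simp
qed

section \<open>The polynomial method\<close>

text \<open>The indicator of \<open>S \<subseteq> A\<close> is the product of the membership
  variables of the elements of \<open>S\<close>, so these are multilinear polynomials in the
  membership bits, with the degree counted separately for each set. Constants arise from empty
  \<open>S\<close> and \<open>S'\<close>.\<close>

inductive indicator_poly :: "nat \<Rightarrow> nat \<Rightarrow> (nat set \<Rightarrow> nat set \<Rightarrow> real) \<Rightarrow> bool" for N d where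
  zero: "indicator_poly N d (\<lambda>A B. 0)"
| add: "indicator_poly N d f \<Longrightarrow> indicator_poly N d g \<Longrightarrow> indicator_poly N d (\<lambda>A B. f A B + g A B)"
| monomial: "S \<subseteq> {1..N} \<Longrightarrow> S' \<subseteq> {1..N} \<Longrightarrow> card S \<le> d \<Longrightarrow> card S' \<le> d \<Longrightarrow>
    indicator_poly N d (\<lambda>A B. c * of_bool (S \<subseteq> A \<and> S' \<subseteq> B))"

lemma indicator_poly_const: "indicator_poly N d (\<lambda>A B. c)"
  using indicator_poly.monomial[of "{}" N "{}" d c] by simp

text \<open>Membership bits are idempotent, so the product of two monomials is the monomial of the
  unions, whose cardinalities are at most the sums.\<close>

lemma indicator_poly_mult_monomial:
  assumes "indicator_poly N e g" "S \<subseteq> {1..N}" "S' \<subseteq> {1..N}" "card S \<le> d" "card S' \<le> d"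
  shows "indicator_poly N (d + e) (\<lambda>A B. c * of_bool (S \<subseteq> A \<and> S' \<subseteq> B) * g A B)"
  using assms(1)
proof (induction rule: indicator_poly.induct)
  case zero
  show ?case by (simp add: indicator_poly.zero)
next
  case (add f g)
  then show ?case by (simp add: distrib_left indicator_poly.add)
next
  case (monomial R R' b)
  have "card (S \<union> R) \<le> d + e" "card (S' \<union> R') \<le> d + e"
    using card_Un_le[of S R] card_Un_le[of S' R'] assms monomial by linarith+
  then have "indicator_poly N (d + e) (\<lambda>A B. (c * b) * of_bool (S \<union> R \<subseteq> A \<and> S' \<union> R' \<subseteq> B))"
    using assms monomial by (intro indicator_poly.monomial) auto
  moreover have "(\<lambda>A B. (c * b) * of_bool (S \<union> R \<subseteq> A \<and> S' \<union> R' \<subseteq> B)) =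
      (\<lambda>A B. c * of_bool (S \<subseteq> A \<and> S' \<subseteq> B) * (b * of_bool (R \<subseteq> A \<and> R' \<subseteq> B)))"
    by (intro ext) auto
  ultimately show ?case by simp
qed

lemma indicator_poly_mult:
  assumes "indicator_poly N d f" "indicator_poly N e g"
  shows "indicator_poly N (d + e) (\<lambda>A B. f A B * g A B)"
  using assms(1)
proof (induction rule: indicator_poly.induct)
  case zero
  show ?case by (simp add: indicator_poly.zero)
next
  case (add f1 f2)
  then show ?case by (simp add: distrib_right indicator_poly.add)
next
  case (monomial S S' c)
  with assms(2) show ?case by (intro indicator_poly_mult_monomial)
qed

lemma indicator_poly_cmult: "indicator_poly N d f \<Longrightarrow> indicator_poly N d (\<lambda>A B. c * f A B)"
  using indicator_poly_mult[OF indicator_poly_const[of N 0 c]] by simp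

lemma indicator_poly_diff:
  "indicator_poly N d f \<Longrightarrow> indicator_poly N d g \<Longrightarrow> indicator_poly N d (\<lambda>A B. f A B - g A B)"
  using indicator_poly.add[OF _ indicator_poly_cmult[of N d g "-1"]] by simp

lemma indicator_poly_sum:
  assumes "\<And>x. x \<in> X \<Longrightarrow> indicator_poly N d (f x)"
  shows "indicator_poly N d (\<lambda>A B. \<Sum>x\<in>X. f x A B)"
  using assms
  by (induction X rule: infinite_finite_induct) (auto intro: indicator_poly.intros)

lemma indicator_poly_member:
  assumes "i \<in> {1..N}"
  shows "indicator_poly N 1 (\<lambda>A B. of_bool (i \<in> (if s then B else A)))"
  using indicator_poly.monomial[of "if s then {} else {i}" N "if s then {i} else {}" 1 1] assms
  by (cases s) auto

section \<open>Amplitudes as polynomials in the membership bits\<close>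

definition complex_indicator_poly :: "nat \<Rightarrow> nat \<Rightarrow> (nat set \<Rightarrow> nat set \<Rightarrow> complex) \<Rightarrow> bool" where
  "complex_indicator_poly N d f \<longleftrightarrow>
    indicator_poly N d (\<lambda>A B. Re (f A B)) \<and> indicator_poly N d (\<lambda>A B. Im (f A B))"

text \<open>The operator does not depend on the sets, so linearity preserves the degree.\<close>

lemma complex_indicator_poly_apply_op:
  assumes "\<And>y. y \<in> X \<Longrightarrow> complex_indicator_poly N d (\<lambda>A B. \<psi> A B y)"
  shows "complex_indicator_poly N d (\<lambda>A B. apply_op X M (\<psi> A B) x)"
  using assms unfolding complex_indicator_poly_def apply_op_def
  by (simp add: indicator_poly_sum indicator_poly.add indicator_poly_diff indicator_poly_cmult)

lemma apply_oracle_op: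
  assumes "x \<in> basis N m"
  shows "apply_op (basis N m) (oracle_op A B) \<psi> x = \<psi> (query A B x)"
proof -
  have "apply_op (basis N m) (oracle_op A B) \<psi> x =
      (\<Sum>y\<in>basis N m. if y = query A B x then \<psi> y else 0)"
    unfolding apply_op_def oracle_op_def by (intro sum.cong) (auto simp: query_query)
  then show ?thesis
    using assms by (simp add: finite_basis query_in_basis_iff)
qed

text \<open>With \<open>v\<close> the queried membership bit, the new amplitude is \<open>v\<close>
  times the old one with flipped answer bit plus \<open>1 - v\<close> times the old one at
  \<open>x\<close>. One query thus raises the degree by one.\<close>

lemma complex_indicator_poly_query:
  assumes "\<And>y. y \<in> basis N m \<Longrightarrow> complex_indicator_poly N d (\<lambda>A B. \<psi> A B y)"
    and "x \<in> basis N m"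
  shows "complex_indicator_poly N (Suc d) (\<lambda>A B. \<psi> A B (query A B x))"
proof -
  obtain s i b z where x: "x = (s, i, b, z)"
    by (cases x) auto
  have i: "i \<in> {1..N}" and basis: "x \<in> basis N m" "(s, i, \<not> b, z) \<in> basis N m"
    using assms(2) by (auto simp: x basis_def)
  define v :: "nat set \<Rightarrow> nat set \<Rightarrow> real" where "v A B = of_bool (i \<in> (if s then B else A))" for A B
  have v: "indicator_poly N 1 v"
    unfolding v_def using indicator_poly_member[OF i, of s] by (simp add: fun_eq_iff)
  \<comment> \<open>The function \<open>p\<close> stands for \<open>Re\<close> and for
    \<open>Im\<close>.\<close>
  have step: "indicator_poly N (Suc d) (\<lambda>A B. p (\<psi> A B (query A B x)))"
    if p: "indicator_poly N d (\<lambda>A B. p (\<psi> A B x))" "indicator_poly N d (\<lambda>A B. p (\<psi> A B (s, i, \<not> b, z)))"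
    for p :: "complex \<Rightarrow> real"
  proof -
    have "indicator_poly N (1 + d) (\<lambda>A B. v A B * p (\<psi> A B (s, i, \<not> b, z)) + (1 - v A B) * p (\<psi> A B x))"
      by (intro indicator_poly.add indicator_poly_mult indicator_poly_diff indicator_poly_const p v)
    moreover have "(\<lambda>A B. v A B * p (\<psi> A B (s, i, \<not> b, z)) + (1 - v A B) * p (\<psi> A B x)) =
        (\<lambda>A B. p (\<psi> A B (query A B x)))"
      by (intro ext) (auto simp: v_def x)
    ultimately show ?thesis by simp
  qed
  show ?thesis
    using assms(1) basis by (simp add: complex_indicator_poly_def step)
qed

lemma complex_indicator_poly_state_after:
  "complex_indicator_poly N t (\<lambda>A B. state_after N Q A B t x)"
proof (induction t arbitrary: x)
  case 0
  show ?case
    by (simp add: complex_indicator_poly_def indicator_poly_const)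
next
  case (Suc t)
  show ?case
    unfolding state_after.simps
    by (intro complex_indicator_poly_apply_op)
      (simp add: apply_oracle_op complex_indicator_poly_query[where \<psi> = "\<lambda>A B. state_after N Q A B t"] Suc)
qed

text \<open>A squared modulus is the sum of the squares of real and imaginary part, which doubles
  the degree.\<close>

lemma indicator_poly_accept_prob: "indicator_poly N (2 * queries Q) (accept_prob N Q)"
proof -
  let ?\<psi> = "\<lambda>A B. state_after N Q A B (queries Q)"
  have "indicator_poly N (queries Q + queries Q)
      (\<lambda>A B. \<Sum>x\<in>accepting Q. Re (?\<psi> A B x) * Re (?\<psi> A B x) + Im (?\<psi> A B x) * Im (?\<psi> A B x))"
    using complex_indicator_poly_state_after[of N "queries Q" Q] unfolding complex_indicator_poly_def
    by (intro indicator_poly_sum indicator_poly.add indicator_poly_mult) blast+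
  moreover have "accept_prob N Q =
      (\<lambda>A B. \<Sum>x\<in>accepting Q. Re (?\<psi> A B x) * Re (?\<psi> A B x) + Im (?\<psi> A B x) * Im (?\<psi> A B x))"
    by (intro ext) (simp add: accept_prob_def cmod_power2 flip: power2_eq_square)
  ultimately show ?thesis
    by (simp add: mult_2)
qed

section \<open>Averaging over sets of fixed sizes\<close>

definition subsets_of_size :: "nat \<Rightarrow> nat \<Rightarrow> nat set set" where
  "subsets_of_size N k = {A. A \<subseteq> {1..N} \<and> card A = k}"

lemma finite_subsets_of_size: "finite (subsets_of_size N k)"
  unfolding subsets_of_size_def by simp

lemma card_subsets_of_size: "card (subsets_of_size N k) = N choose k"
  unfolding subsets_of_size_def using n_subsets[of "{1..N}" k] by simp

text \<open>Removing \<open>S\<close> leaves a choice of \<open>k - card S\<close> elements among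
  \<open>N - card S\<close>. The product form also covers \<open>card S > k\<close>, where both
  sides vanish.\<close>

lemma card_supersets_of_size:
  assumes "S \<subseteq> {1..N}" "k \<le> N"
  shows "card {A \<in> subsets_of_size N k. S \<subseteq> A} * (N choose card S) = (N choose k) * (k choose card S)"
proof (cases "card S \<le> k")
  case True
  have fin: "finite S"
    using assms(1) finite_subset by blast
  have "bij_betw (\<lambda>A. A - S) {A \<in> subsets_of_size N k. S \<subseteq> A}
      {A. A \<subseteq> {1..N} - S \<and> card A = k - card S}"
  proof (rule bij_betw_byWitness[where f' = "\<lambda>A. A \<union> S"])
    show "(\<lambda>A. A - S) ` {A \<in> subsets_of_size N k. S \<subseteq> A} \<subseteq> {A. A \<subseteq> {1..N} - S \<and> card A = k - card S}"
      using fin by (auto simp: subsets_of_size_def card_Diff_subset)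
    show "(\<lambda>A. A \<union> S) ` {A. A \<subseteq> {1..N} - S \<and> card A = k - card S} \<subseteq> {A \<in> subsets_of_size N k. S \<subseteq> A}"
    proof (intro image_subsetI)
      fix A assume A: "A \<in> {A. A \<subseteq> {1..N} - S \<and> card A = k - card S}"
      then have "finite A" "A \<inter> S = {}"
        using finite_subset[of A "{1..N} - S"] by auto
      then have "card (A \<union> S) = k"
        using A fin True by (simp add: card_Un_disjoint)
      then show "A \<union> S \<in> {A \<in> subsets_of_size N k. S \<subseteq> A}"
        using A assms(1) by (auto simp: subsets_of_size_def)
    qed
  qed auto
  then have "card {A \<in> subsets_of_size N k. S \<subseteq> A} = (N - card S) choose (k - card S)"
    using n_subsets[of "{1..N} - S" "k - card S"] assms(1) fin
    by (simp add: bij_betw_same_card card_Diff_subset)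
  then show ?thesis
    using choose_mult[OF True assms(2)] by simp
next
  case False
  have "{A \<in> subsets_of_size N k. S \<subseteq> A} = {}"
    using False card_mono[of _ S] by (auto simp: subsets_of_size_def dest: finite_subset)
  then have "card {A \<in> subsets_of_size N k. S \<subseteq> A} = 0"
    by (simp only: card.empty)
  then show ?thesis
    using False by (simp add: binomial_eq_0)
qed

definition average :: "nat \<Rightarrow> (nat set \<Rightarrow> nat set \<Rightarrow> real) \<Rightarrow> nat \<Rightarrow> nat \<Rightarrow> real" where
  "average N f k l = (\<Sum>A\<in>subsets_of_size N k. \<Sum>B\<in>subsets_of_size N l. f A B) /
    (real (N choose k) * real (N choose l))"

text \<open>The polynomial is the falling factorial divided by \<open>fact m\<close>; it vanishes
  for \<open>k < m\<close>, as required.\<close>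

lemma binomial_poly: "\<exists>p::real poly. degree p \<le> m \<and> (\<forall>k. poly p (real k) = real (k choose m))"
proof -
  define p :: "real poly" where "p = smult (1 / fact m) (\<Prod>i<m. [:- real i, 1:])"
  have "degree (\<Prod>i<m. [:- real i, 1:]) \<le> (\<Sum>i<m. degree [:- real i, 1:])"
    by (rule degree_prod_sum_le[unfolded o_def]) simp
  then have "degree p \<le> m"
    unfolding p_def by (intro order_trans[OF degree_smult_le]) simp
  moreover have "poly p (real k) = real (k choose m)" for k
    by (simp add: p_def poly_prod binomial_gbinomial gbinomial_prod_rev atLeast0LessThan)
  ultimately show ?thesis by blast
qed

text \<open>A fixed set of size \<open>m\<close> lies in a uniformly random \<open>k\<close>-element subset of \<open>{1..N}\<close> with
  probability \<open>(k choose m) / (N choose m)\<close>, which is a polynomial of degree \<open>m\<close> in \<open>k\<close>.\<close>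

lemma average_bipoly:
  assumes "indicator_poly N d f"
  shows "\<exists>p. bipoly d p \<and> (\<forall>k l. k \<le> N \<longrightarrow> l \<le> N \<longrightarrow> average N f k l = p (real k) (real l))"
  using assms
proof (induction rule: indicator_poly.induct)
  case zero
  show ?case
    using bipoly_zero by (force simp: average_def)
next
  case (add f g)
  then obtain p q where "bipoly d p" "bipoly d q"
    "\<forall>k l. k \<le> N \<longrightarrow> l \<le> N \<longrightarrow> average N f k l = p (real k) (real l)"
    "\<forall>k l. k \<le> N \<longrightarrow> l \<le> N \<longrightarrow> average N g k l = q (real k) (real l)"
    by blast
  then show ?case
    by (intro exI[of _ "\<lambda>x y. p x y + q x y"])
      (simp add: bipoly_add average_def sum.distrib add_divide_distrib)
next
  case (monomial S S' c)
  obtain p q :: "real poly" where p: "degree p \<le> card S" "\<And>k. poly p (real k) = real (k choose card S)"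
    and q: "degree q \<le> card S'" "\<And>k. poly q (real k) = real (k choose card S')"
    using binomial_poly by metis
  define p' where "p' = smult (c / (N choose card S)) p"
  define q' where "q' = smult (1 / (N choose card S')) q"
  have "degree p' \<le> d" "degree q' \<le> d"
    using monomial p(1) q(1) degree_smult_le[of _ p] degree_smult_le[of _ q]
    unfolding p'_def q'_def by (meson order_trans)+
  then have "bipoly d (\<lambda>x y. poly p' x * poly q' y)"
    by (rule bipoly_mult_polys)
  moreover have "average N (\<lambda>A B. c * of_bool (S \<subseteq> A \<and> S' \<subseteq> B)) k l = poly p' (real k) * poly q' (real l)"
    if "k \<le> N" "l \<le> N" for k l
  proof -
    have prob: "(\<Sum>A\<in>subsets_of_size N k. of_bool (S \<subseteq> A)) / real (N choose k) =
        real (k choose card S) / real (N choose card S)"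
      if S: "S \<subseteq> {1..N}" and k: "k \<le> N" for S k
    proof -
      have "card S \<le> N"
        using card_mono[OF _ S] by simp
      then have "real (N choose k) \<noteq> 0" "real (N choose card S) \<noteq> 0"
        using k by simp_all
      moreover have "real (card {A \<in> subsets_of_size N k. S \<subseteq> A}) * real (N choose card S) =
          real (N choose k) * real (k choose card S)"
        using card_supersets_of_size[OF S k] by (metis of_nat_mult)
      moreover have "(\<Sum>A\<in>subsets_of_size N k. of_bool (S \<subseteq> A)) =
          real (card {A \<in> subsets_of_size N k. S \<subseteq> A})"
        by (simp add: finite_subsets_of_size sum_of_bool_eq Int_def)
      ultimately show ?thesis
        by (simp add: field_simps)
    qed
    \<comment> \<open>The two sets are averaged independently, so the average of a monomial
      factors.\<close>
    have "average N (\<lambda>A B. c * of_bool (S \<subseteq> A \<and> S' \<subseteq> B)) k l =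
        c * ((\<Sum>A\<in>subsets_of_size N k. of_bool (S \<subseteq> A)) / real (N choose k)) *
          ((\<Sum>B\<in>subsets_of_size N l. of_bool (S' \<subseteq> B)) / real (N choose l))"
      unfolding average_def times_divide_times_eq times_divide_eq_right mult.assoc sum_product
      by (simp add: of_bool_conj flip: sum_distrib_left sum_distrib_right)
    also have "\<dots> = poly p' (real k) * poly q' (real l)"
      using that monomial by (simp add: prob p'_def q'_def p(2) q(2))
    finally show ?thesis .
  qed
  ultimately show ?case by blast
qed

lemma average_bounds:
  assumes "k \<le> N" "l \<le> N"
    and "\<And>A B. A \<subseteq> {1..N} \<Longrightarrow> B \<subseteq> {1..N} \<Longrightarrow> card A = k \<Longrightarrow> card B = l \<Longrightarrow> a \<le> f A B \<and> f A B \<le> b"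
  shows "a \<le> average N f k l" "average N f k l \<le> b"
proof -
  define K where "K = real (N choose k) * real (N choose l)"
  have K: "0 < K"
    using assms(1,2) by (simp add: K_def)
  have const: "(\<Sum>A\<in>subsets_of_size N k. \<Sum>B\<in>subsets_of_size N l. r) = K * r" for r
    by (simp add: K_def card_subsets_of_size)
  have "K * a \<le> (\<Sum>A\<in>subsets_of_size N k. \<Sum>B\<in>subsets_of_size N l. f A B)"
    unfolding const[symmetric] using assms(3) by (intro sum_mono) (auto simp: subsets_of_size_def)
  then show "a \<le> average N f k l"
    using K by (simp add: average_def K_def[symmetric] pos_le_divide_eq mult.commute)
  have "(\<Sum>A\<in>subsets_of_size N k. \<Sum>B\<in>subsets_of_size N l. f A B) \<le> K * b"
    unfolding const[symmetric] using assms(3) by (intro sum_mono) (auto simp: subsets_of_size_def)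
  then show "average N f k l \<le> b"
    using K by (simp add: average_def K_def[symmetric] pos_divide_le_eq mult.commute)
qed

section \<open>The lower bound on the number of queries\<close>

lemma accept_prob_no_queries:
  assumes "queries Q = 0"
  shows "accept_prob N Q A B = accept_prob N Q A' B'"
  using assms by (simp add: accept_prob_def)

theorem theorem2:
  shows "\<exists>c::real. c > 0 \<and>
    (\<forall>(w::nat) (N::nat) (Q::query_algorithm) (T::nat) (\<alpha>::real).
      0 < w \<longrightarrow> w < 2 * w \<longrightarrow> 2 * w \<le> N \<longrightarrow>
      is_query_algorithm N Q \<longrightarrow> queries Q = T \<longrightarrow> \<alpha> > 0 \<longrightarrow>
      (\<forall>A0 A1. A0 \<subseteq> {1..N} \<longrightarrow> A1 \<subseteq> {1..N} \<longrightarrow>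
         (card A0 \<le> w \<or> card A0 \<ge> 2 * w) \<longrightarrow>
         (card A1 \<le> w \<or> card A1 \<ge> 2 * w) \<longrightarrow>
         (card A0 \<ge> 2 * w \<and> card A1 \<ge> 2 * w \<longrightarrow> accept_prob N Q A0 A1 \<ge> 2 * \<alpha>) \<and>
         (card A0 \<le> w \<or> card A1 \<le> w \<longrightarrow> accept_prob N Q A0 A1 \<le> \<alpha>)) \<longrightarrow>
      real T \<ge> c * min (sqrt (real w)) (sqrt (real N / real w)))"
\<comment> \<open>For degree \<open>2T\<close> with \<open>T \<ge> 1\<close>, the required length
  \<open>2 * (160 T\<^sup>2 + 1)\<close> is at most \<open>322 T\<^sup>2\<close>, below
  \<open>(20 T)\<^sup>2\<close>.\<close>
proof (intro exI[of _ "1 / 20"] conjI allI impI)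
  fix w N T :: nat and Q :: query_algorithm and \<alpha> :: real
  assume w: "0 < w" and N: "2 * w \<le> N" and Q: "is_query_algorithm N Q" and T: "queries Q = T"
    and \<alpha>: "\<alpha> > 0"
    and correct: "\<forall>A0 A1. A0 \<subseteq> {1..N} \<longrightarrow> A1 \<subseteq> {1..N} \<longrightarrow>
         (card A0 \<le> w \<or> card A0 \<ge> 2 * w) \<longrightarrow>
         (card A1 \<le> w \<or> card A1 \<ge> 2 * w) \<longrightarrow>
         (card A0 \<ge> 2 * w \<and> card A1 \<ge> 2 * w \<longrightarrow> accept_prob N Q A0 A1 \<ge> 2 * \<alpha>) \<and>
         (card A0 \<le> w \<or> card A1 \<le> w \<longrightarrow> accept_prob N Q A0 A1 \<le> \<alpha>)"
  show "1 / 20 * min (sqrt (real w)) (sqrt (real N / real w)) \<le> real T"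
  proof (rule ccontr)
    assume "\<not> ?thesis"
    then have "20 * real T < sqrt (real w)" "20 * real T < sqrt (real N / real w)"
      by linarith+
    moreover have square_less: "400 * t\<^sup>2 < u" if "20 * t < sqrt u" "0 \<le> t" "0 \<le> u" for t u :: real
    proof -
      have "(20 * t)\<^sup>2 < (sqrt u)\<^sup>2"
        using that by (intro power_strict_mono) auto
      then show ?thesis
        using that by (simp add: power_mult_distrib)
    qed
    ultimately have Tw: "400 * (real T)\<^sup>2 < real w" and TN: "400 * (real T)\<^sup>2 < real N / real w"
      by simp_all
    show False
    \<comment> \<open>The length estimates absorb constants into \<open>T\<^sup>2 \<ge> 1\<close>.
      Without queries the acceptance probability is the same for all inputs, which already
      contradicts the gap.\<close>
    proof (cases "T = 0")
      case True
      have "2 * \<alpha> \<le> accept_prob N Q {1..2 * w} {1..2 * w}" "accept_prob N Q {} {} \<le> \<alpha>"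
        using correct N by auto
      with accept_prob_no_queries[of Q N "{}" "{}" "{1..2 * w}" "{1..2 * w}"] True T \<alpha> show False
        by simp
    next
      case False
      then have T1: "1 \<le> (real T)\<^sup>2"
        by simp
      obtain p where p: "bipoly (2 * T) p"
        "\<And>k l. k \<le> N \<Longrightarrow> l \<le> N \<Longrightarrow> average N (accept_prob N Q) k l = p (real k) (real l)"
        using average_bipoly[OF indicator_poly_accept_prob[of N Q]] T by blast
      show False
      proof (rule bipoly_no_separation[OF p(1) w \<alpha>])
        fix k l assume kl: "2 * w \<le> k" "k \<le> N" "l \<le> w"
        have "0 \<le> accept_prob N Q A B \<and> accept_prob N Q A B \<le> \<alpha>"
          if "A \<subseteq> {1..N}" "B \<subseteq> {1..N}" "card A = k \<and> card B = l \<or> card A = l \<and> card B = k" for A B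
          using correct that kl accept_prob_bounds[OF Q] by auto
        then show "\<bar>p (real k) (real l)\<bar> \<le> \<alpha> \<and> \<bar>p (real l) (real k)\<bar> \<le> \<alpha>"
          using average_bounds[of k N l 0 "accept_prob N Q" \<alpha>]
            average_bounds[of l N k 0 "accept_prob N Q" \<alpha>] kl N p(2)[of k l] p(2)[of l k]
          by (simp add: abs_le_iff)
      next
        have "2 * \<alpha> \<le> average N (accept_prob N Q) (2 * w) (2 * w)"
          using correct N accept_prob_bounds(2)[OF Q] by (intro average_bounds(1)[where b = 1]) auto
        then show "2 * \<alpha> \<le> p (2 * real w) (2 * real w)"
          using p(2)[of "2 * w" "2 * w"] N by simp
        show le_w: "2 * (40 * (real (2 * T))\<^sup>2 + 1) \<le> real w"
          using Tw T1 by (simp add: power_mult_distrib)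
        \<comment> \<open>Since \<open>T \<ge> 1\<close>, \<open>N\<close> exceeds
          \<open>400 w\<close>, so the interval \<open>[2w, N]\<close> is at least as long as
          \<open>[0, w]\<close>.\<close>
        have "400 * real w \<le> 400 * (real T)\<^sup>2 * real w"
          using T1 by (intro mult_right_mono) auto
        also have "\<dots> < real N"
          using TN w by (simp add: field_simps)
        finally have "real w \<le> real N - 2 * real w"
          by linarith
        with le_w show "2 * (40 * (real (2 * T))\<^sup>2 + 1) \<le> real N - 2 * real w"
          by (rule order_trans)
        show "5 / 2 + 40 * (real (2 * T))\<^sup>2 \<le> real N / (2 * real w)"
          using TN T1 by (simp add: power_mult_distrib)
      qed
    qed
  qed
qed simp

end
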